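(* Let $d\ge2$, $p\ge1$, let $C_{\alpha_1,\dots,\alpha_d}\in\mathbb{R}$ be given for all $\alpha\in(\mathbb{Z}^+)^d$ with $|\alpha|=p$, and consider the homogeneous linear partial differential equation $$E_p(u):=\sum_{|\alpha|=p} C_{\alpha_1,\dots,\alpha_d}\,\frac{\partial^p u}{\partial x_1^{\alpha_1}\cdots\partial x_d^{\alpha_d}}=0 .$$ Let $\{\mathbb{E}^n\}_{n=2}^\infty$ be a sequence of extensions with structure constants $\Upsilon^s_{r,k}$, and let $e_1,\dots,e_d$, $e_j=\sum_{r\ge0}a_{jr}I_r$ with $a_{jr}\in\mathbb{C}$, be vectors on this sequence which satisfy on it the characteristic equation $$\sum_{|\alpha|=p} C_{\alpha_1,\dots,\alpha_d}\,e_1^{\alpha_1}\cdots e_d^{\alpha_d}=0 ,$$ where at least one of $a_{10},\dots,a_{d0}$ belongs to $\mathbb{C}\setminus\mathbb{R}$. Let $\xi=\sum_j x_ja_{j0}$, $\xi_s=\sum_j x_ja_{js}$ ($s\ge1$), and let $A_k=A_k(x_1,\dots,x_d,t)$ be defined for $t\ne\xi$ by $$A_0=\frac1{t-\xi},\quad A_1=\frac{\xi_1}{(t-\xi)^2},\quad A_s=\frac{\xi_s}{(t-\xi)^2}+\frac1{t-\xi}\sum_{r=1}^{s-1}A_r B_{r,s},\quad B_{r,s}=\sum_{k=1}^{s-1}\xi_k\Upsilon^k_{r,s},\quad s\ge2 .$$ Let $D\subset\mathbb{C}$ be a domain and let $F_k$, $k=0,1,2,\dots$, be arbitrary holomorphic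 functions in $D$. Then for every $k=0,1,2,\dots$ the function $$U_k(x_1,\dots,x_d)=\frac1{2\pi i}\int_\Gamma F_k(t)\,A_k(x_1,\dots,x_d,t)\,dt$$ satisfies $E_p(U_k)=0$ on $\{(x_1,\dots,x_d)\in\mathbb{R}^d:\ \xi\in D\}$, where $\Gamma$ is a closed Jordan rectifiable curve (positively oriented) lying in $D$ together with its interior and surrounding the point $\xi=\xi(x_1,\dots,x_d)$.
   Context: $\mathbb{Z}^+=\{0,1,2,\dots\}$ and $|\alpha|=\alpha_1+\dots+\alpha_d$. Sequence of extensions. For each $n\ge2$, $\mathbb{E}^n$ is an $n$-dimensional commutative associative unital algebra over $\mathbb{C}$ whose only nonzero idempotent is the unit, with basis $I_0=1,I_1,\dots,I_{n-1}$ and multiplication $$I_rI_s=\sum_{k=\max\{r,s\}+1}^{n-1}\Upsilon^s_{r,k}I_k\qquad (1\le r,s\le n-1),$$ and the structure constants of $\mathbb{E}^{n+1}$ coincide with those of $\mathbb{E}^n$ for all indices $k\in\{2,\dots,n-1\}$, $r,s\in\{1,\dots,k-1\}$ (i.e. deleting the last basis element of $\mathbb{E}^{n+1}$ from its multiplication table gives the table of $\mathbb{E}^n$; $\mathbb{E}^{n+1}$ is called an extension of $\mathbb{E}^n$). Hence the constants $\Upsilon^s_{r,k}$ do not depend on $n$. They are taken to be $0$ when $k\le\max\{r,s\}$. A vector $e=\sum_{r\ge0}c_rI_r$ ($c_r\in\mathbb{C}$) on the sequence means the family of truncations $e(n)=\sum_{r=0}^{n-1}c_rI_r\in\mathbb{E}^n$,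 $n=2,3,\dots$. Vectors $e_1,\dots,e_d$ satisfy an algebraic equation on the sequence if for every $n=2,3,\dots$ the truncations $e_1(n),\dots,e_d(n)$ satisfy it in $\mathbb{E}^n$. *)

theory Defs
  imports "HOL-Complex_Analysis.Complex_Analysis" "HOL-Algebra.Module"
begin

section \<open>Classical solutions of homogeneous linear PDEs with constant coefficients\<close>

definition partial_deriv ::
    "'d::finite \<Rightarrow> (real^'d \<Rightarrow> complex) \<Rightarrow> real^'d \<Rightarrow> complex" where
  "partial_deriv j u x = vector_derivative (\<lambda>h. u (x + h *\<^sub>R axis j 1)) (at 0)"

text \<open>\<^term>\<open>iter_partial [j, k, l] u\<close> is the derivative of \<open>u\<close> first in direction \<open>l\<close>,
  then \<open>k\<close>, then \<open>j\<close>.\<close>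

definition iter_partial ::
    "'d::finite list \<Rightarrow> (real^'d \<Rightarrow> complex) \<Rightarrow> real^'d \<Rightarrow> complex" where
  "iter_partial js u = foldr partial_deriv js u"

text \<open>For a multi-index \<open>\<alpha>\<close>, the variables are ordered by the linear order on the index type,
  so that the operator is \<open>\<partial>\<^sub>1\<^bsup>\<alpha>(1)\<^esup> \<dots> \<partial>\<^sub>d\<^bsup>\<alpha>(d)\<^esup>\<close>.\<close>

definition mixed_partial ::
    "('d::{finite,linorder} \<Rightarrow> nat) \<Rightarrow> (real^('d::{finite,linorder}) \<Rightarrow> complex) \<Rightarrow> real^('d::{finite,linorder}) \<Rightarrow> complex" where
  "mixed_partial \<alpha> u =
     iter_partial (concat (map (\<lambda>j. replicate (\<alpha> j) j) (sorted_list_of_set UNIV))) u"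

definition C_k_on :: "nat \<Rightarrow> (real^'d::finite \<Rightarrow> complex) \<Rightarrow> (real^'d) set \<Rightarrow> bool" where
  "C_k_on p u S \<longleftrightarrow>
     (\<forall>js. length js \<le> p \<longrightarrow> continuous_on S (iter_partial js u)) \<and>
     (\<forall>js. length js < p \<longrightarrow> (\<forall>x\<in>S. \<forall>j.
        (\<lambda>h. iter_partial js u (x + h *\<^sub>R axis j 1)) differentiable (at 0)))"

definition multi_indices :: "nat \<Rightarrow> ('d::finite \<Rightarrow> nat) set" where
  "multi_indices p = {\<alpha>. (\<Sum>j\<in>UNIV. \<alpha> j) = p}"

definition pde_operator :: "nat \<Rightarrow> (('d::{finite,linorder} \<Rightarrow> nat) \<Rightarrow> real) \<Rightarrow>
    (real^('d::{finite,linorder}) \<Rightarrow> complex) \<Rightarrow> real^('d::{finite,linorder}) \<Rightarrow> complex" where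
  "pde_operator p C u x = (\<Sum>\<alpha>\<in>multi_indices p. of_real (C \<alpha>) * mixed_partial \<alpha> u x)"

definition classical_solution_on :: "nat \<Rightarrow> (('d::{finite,linorder} \<Rightarrow> nat) \<Rightarrow> real) \<Rightarrow>
    (real^('d::{finite,linorder}) \<Rightarrow> complex) \<Rightarrow> (real^('d::{finite,linorder})) set \<Rightarrow> bool" where
  "classical_solution_on p C u S \<longleftrightarrow> C_k_on p u S \<and> (\<forall>x\<in>S. pde_operator p C u x = 0)"


section \<open>Sequences of extensions of commutative algebras\<close>

definition complex_ring :: "complex ring" where
  "complex_ring = \<lparr>carrier = UNIV, monoid.mult = (*), one = 1, ring.zero = 0, add = (+)\<rparr>"

definition lin_comb ::
    "(complex, 'e) module \<Rightarrow> (nat \<Rightarrow> 'e) \<Rightarrow> (nat \<Rightarrow> complex) \<Rightarrow> nat \<Rightarrow> 'e" where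
  "lin_comb A b c n = (\<Oplus>\<^bsub>A\<^esub>r\<in>{..<n}. c r \<odot>\<^bsub>A\<^esub> b r)"

definition is_basis :: "(complex, 'e) module \<Rightarrow> (nat \<Rightarrow> 'e) \<Rightarrow> nat \<Rightarrow> bool" where
  "is_basis A b n \<longleftrightarrow>
     b \<in> {..<n} \<rightarrow> carrier A \<and>
     (\<forall>v\<in>carrier A. \<exists>!c. c \<in> {..<n} \<rightarrow>\<^sub>E UNIV \<and> v = lin_comb A b c n)"

text \<open>\<open>E n\<close> is the algebra of dimension \<open>n\<close>, with basis \<open>I n 0, \<dots>, I n (n - 1)\<close>;
  the number \<open>\<Upsilon> r s k\<close> is the coefficient of \<open>I n k\<close> in the product of \<open>I n r\<close>
  and \<open>I n s\<close> (upper index \<open>s\<close>, lower indices \<open>r, k\<close>). That \<open>E (n + 1)\<close> is an extension of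
  \<open>E n\<close> is expressed by \<open>\<Upsilon>\<close> not depending on \<open>n\<close>.\<close>

definition extension_sequence :: "(nat \<Rightarrow> (complex, 'e) module) \<Rightarrow> (nat \<Rightarrow> nat \<Rightarrow> 'e) \<Rightarrow>
    (nat \<Rightarrow> nat \<Rightarrow> nat \<Rightarrow> complex) \<Rightarrow> bool" where
  "extension_sequence E I \<Upsilon> \<longleftrightarrow>
     (\<forall>n\<ge>2.
        Module.algebra complex_ring (E n) \<and>
        is_basis (E n) (I n) n \<and>
        I n 0 = \<one>\<^bsub>E n\<^esub> \<and>
        (\<forall>r\<in>{1..n-1}. \<forall>s\<in>{1..n-1}.
           I n r \<otimes>\<^bsub>E n\<^esub> I n s =
             (\<Oplus>\<^bsub>E n\<^esub>k\<in>{max r s + 1..n-1}. \<Upsilon> r s k \<odot>\<^bsub>E n\<^esub> I n k)) \<and>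
        {v \<in> carrier (E n). v \<otimes>\<^bsub>E n\<^esub> v = v \<and> v \<noteq> \<zero>\<^bsub>E n\<^esub>} = {\<one>\<^bsub>E n\<^esub>}) \<and>
     (\<forall>r\<ge>1. \<forall>s\<ge>1. \<forall>k. k \<le> max r s \<longrightarrow> \<Upsilon> r s k = 0)"

text \<open>The vector \<open>e\<^sub>j\<close> is given by its coefficients \<open>a j r\<close>, and its truncation in \<open>E n\<close> is
  \<^term>\<open>lin_comb (E n) (I n) (a j) n\<close>.\<close>

definition characteristic_equation :: "nat \<Rightarrow> (('d::finite \<Rightarrow> nat) \<Rightarrow> real) \<Rightarrow>
    (nat \<Rightarrow> (complex, 'e) module) \<Rightarrow> (nat \<Rightarrow> nat \<Rightarrow> 'e) \<Rightarrow> ('d \<Rightarrow> nat \<Rightarrow> complex) \<Rightarrow> bool" where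
  "characteristic_equation p C E I a \<longleftrightarrow>
     (\<forall>n\<ge>2. (\<Oplus>\<^bsub>E n\<^esub>\<alpha>\<in>multi_indices p. of_real (C \<alpha>) \<odot>\<^bsub>E n\<^esub>
        (\<Otimes>\<^bsub>E n\<^esub>j\<in>UNIV. lin_comb (E n) (I n) (a j) n [^]\<^bsub>E n\<^esub> \<alpha> j)) = \<zero>\<^bsub>E n\<^esub>)"


section \<open>The resolvent coefficients\<close>

definition xi :: "('d::finite \<Rightarrow> nat \<Rightarrow> complex) \<Rightarrow> real^'d \<Rightarrow> nat \<Rightarrow> complex" where
  "xi a x s = (\<Sum>j\<in>UNIV. of_real (x $ j) * a j s)"

definition B_coeff :: "(nat \<Rightarrow> nat \<Rightarrow> nat \<Rightarrow> complex) \<Rightarrow> (nat \<Rightarrow> complex) \<Rightarrow> nat \<Rightarrow> nat \<Rightarrow> complex"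
  where "B_coeff \<Upsilon> z r s = (\<Sum>k\<in>{1..s-1}. z k * \<Upsilon> r k s)"

text \<open>Here \<open>z 0\<close> stands for \<open>\<xi>\<close> and \<open>z s\<close> for \<open>\<xi>\<^sub>s\<close>.\<close>

fun A_coeff :: "(nat \<Rightarrow> nat \<Rightarrow> nat \<Rightarrow> complex) \<Rightarrow> (nat \<Rightarrow> complex) \<Rightarrow> complex \<Rightarrow> nat \<Rightarrow> complex"
  where
  "A_coeff \<Upsilon> z t 0 = 1 / (t - z 0)"
| "A_coeff \<Upsilon> z t (Suc 0) = z 1 / (t - z 0)^2"
| "A_coeff \<Upsilon> z t (Suc (Suc m)) =
     z (m + 2) / (t - z 0)^2 +
     1 / (t - z 0) * (\<Sum>r\<in>{1..Suc m}. A_coeff \<Upsilon> z t r * B_coeff \<Upsilon> z r (m + 2))"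


section \<open>Integrals along rectifiable curves\<close>

text \<open>The library's contour integral is an integral against the derivative of the path, which is
  not the line integral for a general rectifiable path. The line integral is therefore defined as
  a Riemann-Stieltjes integral.\<close>

definition rectifiable_path :: "(real \<Rightarrow> complex) \<Rightarrow> bool" where
  "rectifiable_path \<gamma> \<longleftrightarrow> path \<gamma> \<and>
     (\<exists>L. \<forall>\<D>. \<D> division_of {0..1} \<longrightarrow> (\<Sum>K\<in>\<D>. norm (\<gamma> (Sup K) - \<gamma> (Inf K))) \<le> L)"

definition has_line_integral ::
    "(complex \<Rightarrow> complex) \<Rightarrow> complex \<Rightarrow> (real \<Rightarrow> complex) \<Rightarrow> bool" where
  "has_line_integral f w \<gamma> \<longleftrightarrow>
     (\<forall>\<epsilon>>0. \<exists>\<delta>>0. \<forall>\<D>. \<D> tagged_division_of {0..1} \<and> (\<lambda>t. ball t \<delta>) fine \<D> \<longrightarrow>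
        norm ((\<Sum>(t, K)\<in>\<D>. f (\<gamma> t) * (\<gamma> (Sup K) - \<gamma> (Inf K))) - w) < \<epsilon>)"

definition line_integral :: "(real \<Rightarrow> complex) \<Rightarrow> (complex \<Rightarrow> complex) \<Rightarrow> complex" where
  "line_integral \<gamma> f = (THE w. has_line_integral f w \<gamma>)"

text \<open>Positive orientation: the winding number about the enclosed points is \<open>1\<close>.\<close>

definition jordan_contour :: "complex set \<Rightarrow> complex \<Rightarrow> (real \<Rightarrow> complex) \<Rightarrow> bool" where
  "jordan_contour D w \<gamma> \<longleftrightarrow>
     rectifiable_path \<gamma> \<and> simple_path \<gamma> \<and> pathfinish \<gamma> = pathstart \<gamma> \<and>
     path_image \<gamma> \<union> inside (path_image \<gamma>) \<subseteq> D \<and>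
     w \<in> inside (path_image \<gamma>) \<and>
     (\<forall>z\<in>inside (path_image \<gamma>). winding_number \<gamma> z = 1)"

end

theory Submission
  imports Defs
begin

text \<open>
  The algebras \<open>E n\<close> are the truncations of one commutative associative algebra, whose elements are the
  coefficient sequences \<open>u = (u 0, u 1, \<dots>)\<close> with the product given by the structure constants. Every
  product of two elements with zeroth coefficient \<open>0\<close> is shifted to higher indices, so
  \<open>z = \<xi> + N\<close> with \<open>N = (0, \<xi>\<^sub>1, \<xi>\<^sub>2, \<dots>)\<close> is a scalar plus a (topologically) nilpotent element, and a
  holomorphic \<open>F\<close> extends to it by the Taylor formula
  \<open>F(z) = (\<Sum>m. F\<^bsup>(m)\<^esup>(\<xi>) / m! * N\<^sup>m)\<close>, a finite sum in each coefficient.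

  Applied to the resolvent \<open>1 / (t - z) = (\<Sum>m. N\<^sup>m / (t - \<xi>)\<^bsup>m+1\<^esup>)\<close>, this identifies \<open>A\<^sub>k\<close>: comparing
  coefficients in \<open>(t - \<xi>) R = 1 + N R\<close> gives exactly the defining recursion
  (\<open>A_coeff_eq_sum_seq_pow\<close>). Cauchy's formula for the derivatives of \<open>F\<close> then
  turns the contour integral \<open>U\<^sub>k\<close> into the \<open>k\<close>-th coefficient of \<open>F\<^sub>k(z)\<close>
  (\<open>line_integral_jordan_contour\<close>).

  Since \<open>z = (\<Sum>j. x\<^sub>j e\<^sub>j)\<close>, the chain rule reads \<open>\<partial>\<^sub>j F(z) = e\<^sub>j * F'(z)\<close>
  (\<open>has_vector_derivative_hol_ext\<close>). Hence the operator \<open>E\<^sub>p\<close> acts on \<open>F(z)\<close> as multiplication of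
  \<open>F\<^bsup>(p)\<^esup>(z)\<close> by the characteristic polynomial evaluated at \<open>e\<^sub>1, \<dots>, e\<^sub>d\<close>, which vanishes. As only
  finitely many coefficients are involved at a time, commutativity, associativity and the
  characteristic equation may all be read off in \<open>E n\<close> for a single large \<open>n\<close>.
\<close>

section \<open>Line integrals along rectifiable Jordan curves\<close>

lemma has_line_integral_unique:
  assumes "has_line_integral f v \<gamma>" "has_line_integral f w \<gamma>"
  shows "v = w"
proof (rule ccontr)
  assume "v \<noteq> w"
  define \<epsilon> where "\<epsilon> = norm (v - w) / 2"
  have \<epsilon>: "\<epsilon> > 0" using \<open>v \<noteq> w\<close> by (simp add: \<epsilon>_def)
  let ?S = "\<lambda>\<D>. \<Sum>(t, K)\<in>\<D>. f (\<gamma> t) * (\<gamma> (Sup K) - \<gamma> (Inf K))"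
  obtain \<delta>1 where 1: "\<delta>1 > 0" "\<forall>\<D>. \<D> tagged_division_of {0..1} \<and> (\<lambda>t. ball t \<delta>1) fine \<D> \<longrightarrow>
      norm (?S \<D> - v) < \<epsilon>"
    using assms(1)[unfolded has_line_integral_def, rule_format, OF \<epsilon>] by (elim exE conjE)
  obtain \<delta>2 where 2: "\<delta>2 > 0" "\<forall>\<D>. \<D> tagged_division_of {0..1} \<and> (\<lambda>t. ball t \<delta>2) fine \<D> \<longrightarrow>
      norm (?S \<D> - w) < \<epsilon>"
    using assms(2)[unfolded has_line_integral_def, rule_format, OF \<epsilon>] by (elim exE conjE)
  have "gauge (\<lambda>t::real. ball t (min \<delta>1 \<delta>2))"
    using 1 2 by (intro gauge_ball_dependent) auto
  then obtain \<D> where \<D>: "\<D> tagged_division_of {0..1::real}" "(\<lambda>t. ball t (min \<delta>1 \<delta>2)) fine \<D>"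
    by (rule fine_division_exists_real)
  have "(\<lambda>t. ball t \<delta>1) fine \<D>" "(\<lambda>t. ball t \<delta>2) fine \<D>"
    using \<D>(2) by (fastforce simp: fine_def subset_iff)+
  then have "norm (?S \<D> - v) < \<epsilon>" "norm (?S \<D> - w) < \<epsilon>"
    using 1 2 \<D> by auto
  then have "norm (v - w) < \<epsilon> + \<epsilon>"
    using norm_diff_triangle_less[of v "?S \<D>" \<epsilon> w \<epsilon>] by (simp add: norm_minus_commute)
  then show False by (simp add: \<epsilon>_def)
qed

lemma line_integral_unique:
  "has_line_integral f w \<gamma> \<Longrightarrow> line_integral \<gamma> f = w"
  unfolding line_integral_def by (blast intro: has_line_integral_unique the_equality)

text \<open>
  Different tags may carry the same interval only if it is a single point, where the increment of
  \<open>\<gamma>\<close> is zero; so tagged divisions obey the bound that defines rectifiability.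
\<close>

lemma rectifiable_tagged_sum_bound:
  assumes "rectifiable_path \<gamma>"
  obtains L where "L > 0" "\<And>\<D>. \<D> tagged_division_of {0..1} \<Longrightarrow>
     (\<Sum>(t, K)\<in>\<D>. norm (\<gamma> (Sup K) - \<gamma> (Inf K))) \<le> L"
proof -
  obtain L where L: "\<And>\<D>. \<D> division_of {0..1} \<Longrightarrow> (\<Sum>K\<in>\<D>. norm (\<gamma> (Sup K) - \<gamma> (Inf K))) \<le> L"
    using assms unfolding rectifiable_path_def by blast
  have "(\<Sum>(t, K)\<in>\<D>. norm (\<gamma> (Sup K) - \<gamma> (Inf K))) \<le> \<bar>L\<bar> + 1"
    if \<D>: "\<D> tagged_division_of {0..1}" for \<D>
  proof -
    \<comment> \<open>The empty interval needs a value of its own, because \<open>Sup {}\<close> and \<open>Inf {}\<close> are unspecified.\<close>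
    let ?d = "\<lambda>K. if K = {} then 0 else norm (\<gamma> (Sup K) - \<gamma> (Inf K))"
    have ne: "K \<noteq> {}" if "(t, K) \<in> \<D>" for t K
      using tagged_division_ofD(2)[OF \<D> that] by auto
    have "(\<Sum>(t, K)\<in>\<D>. norm (\<gamma> (Sup K) - \<gamma> (Inf K))) = (\<Sum>(t, K)\<in>\<D>. ?d K)"
      using ne by (intro sum.cong) auto
    also have "\<dots> = (\<Sum>K\<in>snd ` \<D>. ?d K)"
    proof (rule sum.over_tagged_division_lemma[OF \<D>])
      fix u v :: real
      assume "box u v = {}"
      then consider "u = v" | "v < u" by fastforce
      then show "?d (cbox u v) = 0" by cases auto
    qed
    also have "\<dots> = (\<Sum>K\<in>snd ` \<D>. norm (\<gamma> (Sup K) - \<gamma> (Inf K)))"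
      using ne by (intro sum.cong) auto
    also have "\<dots> \<le> L"
      by (rule L) (rule division_of_tagged_division[OF \<D>])
    finally show ?thesis by simp
  qed
  then show ?thesis using that[of "\<bar>L\<bar> + 1"] by simp
qed

text \<open>
  A rectifiable path has no derivative to integrate against, so Cauchy's theorem reaches it only
  through a smooth path \<open>p\<close> nearby. The function \<open>\<Phi>\<close> in the proof integrates \<open>f\<close> along \<open>p\<close> up to
  time \<open>t\<close> and then along the segment from \<open>p t\<close> to \<open>\<gamma> t\<close>. On a short interval \<open>{b..c}\<close> everything
  lies in a disc on which \<open>f\<close> has a primitive \<open>g\<close>, so that \<open>\<Phi> c - \<Phi> b = g (\<gamma> c) - g (\<gamma> b)\<close>, which
  differs from \<open>f (\<gamma> t) * (\<gamma> c - \<gamma> b)\<close> by a small multiple of the length of the chord. Summation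
  telescopes on the one side and produces the Riemann-Stieltjes sum on the other.
\<close>

lemma has_line_integral_nearby_path:
  assumes rect: "rectifiable_path \<gamma>" and holo: "f holomorphic_on V" and V: "open V"
    and p: "valid_path p" "pathstart p = pathstart \<gamma>" "pathfinish p = pathfinish \<gamma>"
    and r: "r > 0" "\<And>t. t \<in> {0..1} \<Longrightarrow> ball (\<gamma> t) r \<subseteq> V"
    and near: "\<And>t. t \<in> {0..1} \<Longrightarrow> norm (p t - \<gamma> t) < r / 2"
  shows "has_line_integral f (contour_integral p f) \<gamma>"
  unfolding has_line_integral_def
proof (intro allI impI)
  fix \<epsilon> :: real assume \<epsilon>: "\<epsilon> > 0"
  obtain L where L: "L > 0" "\<And>\<D>. \<D> tagged_division_of {0..1} \<Longrightarrow>
     (\<Sum>(t, K)\<in>\<D>. norm (\<gamma> (Sup K) - \<gamma> (Inf K))) \<le> L"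
    using rectifiable_tagged_sum_bound[OF rect] by blast
  have path: "path \<gamma>" using rect by (simp add: rectifiable_path_def)
  define \<eta> where "\<eta> = \<epsilon> / (2 * L)"
  have \<eta>: "\<eta> > 0" using \<epsilon> L by (simp add: \<eta>_def)
  obtain \<rho> where \<rho>: "\<rho> > 0" "\<rho> \<le> r / 2"
     "\<And>t z. t \<in> {0..1} \<Longrightarrow> z \<in> ball (\<gamma> t) \<rho> \<Longrightarrow> norm (f z - f (\<gamma> t)) \<le> \<eta>"
  proof -
    let ?K = "\<Union>z\<in>path_image \<gamma>. cball z (r / 2)"
    have "compact ?K"
      by (intro compact_minkowski_sum_cball compact_path_image path)
    moreover have "?K \<subseteq> V"
      using r by (fastforce simp: path_image_def)
    ultimately have "uniformly_continuous_on ?K f"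
      by (intro compact_uniformly_continuous continuous_on_subset[OF holomorphic_on_imp_continuous_on[OF holo]])
    then obtain d where d: "d > 0" "\<And>x y. x \<in> ?K \<Longrightarrow> y \<in> ?K \<Longrightarrow> dist y x < d \<Longrightarrow> dist (f y) (f x) < \<eta>"
      using \<eta> unfolding uniformly_continuous_on_def by metis
    show ?thesis
    proof (rule that[of "min d (r / 2)"])
      fix t z assume t: "t \<in> {0..1}" and z: "z \<in> ball (\<gamma> t) (min d (r / 2))"
      have "\<gamma> t \<in> path_image \<gamma>" using t by (simp add: path_image_def)
      then have "\<gamma> t \<in> ?K" "z \<in> ?K" using z r by force+
      then have "dist (f z) (f (\<gamma> t)) < \<eta>" using d(2) z by (simp add: dist_commute)
      then show "norm (f z - f (\<gamma> t)) \<le> \<eta>" by (simp add: dist_norm)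
    qed (use d r in auto)
  qed
  have "uniformly_continuous_on {0..1} \<gamma>"
    using path compact_uniformly_continuous by (auto simp: path_def)
  then obtain \<delta> where \<delta>: "\<delta> > 0"
     "\<And>s t. s \<in> {0..1} \<Longrightarrow> t \<in> {0..1} \<Longrightarrow> dist s t < \<delta> \<Longrightarrow> dist (\<gamma> s) (\<gamma> t) < \<rho>"
    using \<rho>(1) unfolding uniformly_continuous_on_def by metis
  have p_in: "p t \<in> V" if "t \<in> {0..1}" for t
    using near[OF that] r(1) r(2)[OF that] by (auto simp: dist_norm norm_minus_commute subset_iff)
  then have "path_image p \<subseteq> V" by (auto simp: path_image_def)
  then have f_int: "f contour_integrable_on p"
    using contour_integrable_holomorphic_simple holo V p(1) by blast
  define \<Phi> where "\<Phi> = (\<lambda>t. contour_integral (subpath 0 t p) f + contour_integral (linepath (p t) (\<gamma> t)) f)"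
  have \<Phi>01: "\<Phi> 1 - \<Phi> 0 = contour_integral p f"
    using p(2,3) by (simp add: \<Phi>_def pathstart_def pathfinish_def)
  show "\<exists>\<delta>>0. \<forall>\<D>. \<D> tagged_division_of {0..1} \<and> (\<lambda>t. ball t \<delta>) fine \<D> \<longrightarrow>
        norm ((\<Sum>(t, K)\<in>\<D>. f (\<gamma> t) * (\<gamma> (Sup K) - \<gamma> (Inf K))) - contour_integral p f) < \<epsilon>"
  proof (intro exI[of _ \<delta>] conjI allI impI)
    fix \<D> assume "\<D> tagged_division_of {0..1::real} \<and> (\<lambda>t. ball t \<delta>) fine \<D>"
    then have \<D>: "\<D> tagged_division_of {0..1}" and fine: "(\<lambda>t. ball t \<delta>) fine \<D>" by auto
    have local_bound: "norm (f (\<gamma> t) * (\<gamma> (Sup K) - \<gamma> (Inf K)) - (\<Phi> (Sup K) - \<Phi> (Inf K)))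
        \<le> \<eta> * norm (\<gamma> (Sup K) - \<gamma> (Inf K))" if tK: "(t, K) \<in> \<D>" for t K
    proof -
      obtain b c where K: "K = {b..c}" "t \<in> K" "K \<subseteq> {0..1}"
        using tagged_division_ofD(2,3,4)[OF \<D> tK] by (metis box_real(2))
      then have bc: "b \<le> c" "t \<in> {0..1}" "{b..c} \<subseteq> {0..1}" "Sup K = c" "Inf K = b" by auto
      have near_t: "\<gamma> s \<in> ball (\<gamma> t) \<rho>" if "s \<in> {b..c}" for s
      proof -
        have "dist t s < \<delta>" using fine tK K that by (fastforce simp: fine_def)
        then show ?thesis using \<delta>(2)[of t s] bc that by (auto simp: dist_commute)
      qed
      have p_near_t: "p s \<in> ball (\<gamma> t) r" if "s \<in> {b..c}" for s
      proof -
        have "norm (p s - \<gamma> s) < r / 2" using near bc that by blast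
        moreover have "norm (\<gamma> t - \<gamma> s) < r / 2" using near_t[OF that] \<rho>(2) by (simp add: dist_norm)
        ultimately have "norm (\<gamma> t - p s) < r" by norm
        then show ?thesis by (simp add: dist_norm)
      qed
      have sub: "ball (\<gamma> t) \<rho> \<subseteq> ball (\<gamma> t) r" using \<rho> r by (intro subset_ball) auto
      have "f holomorphic_on ball (\<gamma> t) r" using holo r(2)[OF bc(2)] holomorphic_on_subset by blast
      then obtain g where g: "\<And>z. z \<in> ball (\<gamma> t) r \<Longrightarrow> (g has_field_derivative f z) (at z within ball (\<gamma> t) r)"
        using holomorphic_convex_primitive' by (metis convex_ball open_ball)
      have prim: "contour_integral q f = g (pathfinish q) - g (pathstart q)"
        if "valid_path q" "path_image q \<subseteq> ball (\<gamma> t) r" for q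
        using contour_integral_unique[OF contour_integral_primitive[OF g that]] .
      have seg: "contour_integral (linepath (p s) (\<gamma> s)) f = g (\<gamma> s) - g (p s)" if "s \<in> {b..c}" for s
      proof -
        have "closed_segment (p s) (\<gamma> s) \<subseteq> ball (\<gamma> t) r"
          using p_near_t[OF that] near_t[OF that] sub by (intro closed_segment_subset) auto
        then show ?thesis using prim[of "linepath (p s) (\<gamma> s)"] by simp
      qed
      have bc01: "b \<in> {0..1}" "c \<in> {0..1}" using bc by auto
      have sub_bc: "contour_integral (subpath b c p) f = g (p c) - g (p b)"
      proof -
        have "path_image (subpath b c p) \<subseteq> ball (\<gamma> t) r"
          using bc p_near_t by (auto simp: path_image_subpath)
        then show ?thesis using prim[of "subpath b c p"] valid_path_subpath[OF p(1)] bc01 by simp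
      qed
      have comb: "contour_integral (subpath 0 b p) f + contour_integral (subpath b c p) f
          = contour_integral (subpath 0 c p) f"
        using contour_integral_subpath_combine[OF f_int p(1)] bc01 by simp
      have seg_bc: "contour_integral (linepath (p b) (\<gamma> b)) f = g (\<gamma> b) - g (p b)"
          "contour_integral (linepath (p c) (\<gamma> c)) f = g (\<gamma> c) - g (p c)"
        using seg[of b] seg[of c] bc(1) by auto
      have "\<Phi> c - \<Phi> b = g (\<gamma> c) - g (\<gamma> b)"
        unfolding \<Phi>_def comb[symmetric] sub_bc seg_bc by (simp add: algebra_simps)
      moreover have "norm ((g (\<gamma> c) - f (\<gamma> t) * \<gamma> c) - (g (\<gamma> b) - f (\<gamma> t) * \<gamma> b)) \<le> \<eta> * norm (\<gamma> c - \<gamma> b)"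
      proof (rule field_differentiable_bound[where S = "ball (\<gamma> t) \<rho>" and f' = "\<lambda>z. f z - f (\<gamma> t)"])
        fix z assume z: "z \<in> ball (\<gamma> t) \<rho>"
        then have "(g has_field_derivative f z) (at z within ball (\<gamma> t) \<rho>)"
          using g sub by (meson DERIV_subset subsetD)
        then show "((\<lambda>z. g z - f (\<gamma> t) * z) has_field_derivative f z - f (\<gamma> t)) (at z within ball (\<gamma> t) \<rho>)"
          by (auto intro!: derivative_eq_intros)
        show "norm (f z - f (\<gamma> t)) \<le> \<eta>" using \<rho>(3) bc(2) z by blast
      qed (use near_t bc in auto)
      moreover have "f (\<gamma> t) * (\<gamma> c - \<gamma> b) - (g (\<gamma> c) - g (\<gamma> b)) =
          - ((g (\<gamma> c) - f (\<gamma> t) * \<gamma> c) - (g (\<gamma> b) - f (\<gamma> t) * \<gamma> b))"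
        by (simp add: algebra_simps)
      ultimately show ?thesis
        using bc(4,5) by (metis norm_minus_cancel)
    qed
    have "(\<Sum>(t, K)\<in>\<D>. \<Phi> (Sup K) - \<Phi> (Inf K)) = contour_integral p f"
      using additive_tagged_division_1[OF _ \<D>, of \<Phi>] \<Phi>01 by simp
    then have "norm ((\<Sum>(t, K)\<in>\<D>. f (\<gamma> t) * (\<gamma> (Sup K) - \<gamma> (Inf K))) - contour_integral p f)
        = norm (\<Sum>(t, K)\<in>\<D>. f (\<gamma> t) * (\<gamma> (Sup K) - \<gamma> (Inf K)) - (\<Phi> (Sup K) - \<Phi> (Inf K)))"
      by (simp add: split_def sum_subtractf)
    also have "\<dots> \<le> (\<Sum>(t, K)\<in>\<D>. \<eta> * norm (\<gamma> (Sup K) - \<gamma> (Inf K)))"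
      using local_bound by (intro sum_norm_le) auto
    also have "\<dots> = \<eta> * (\<Sum>(t, K)\<in>\<D>. norm (\<gamma> (Sup K) - \<gamma> (Inf K)))"
      by (simp add: split_def sum_distrib_left)
    also have "\<dots> \<le> \<eta> * L" using L(2)[OF \<D>] \<eta> by simp
    also have "\<dots> < \<epsilon>" using L(1) \<epsilon> by (simp add: \<eta>_def)
    finally show "norm ((\<Sum>(t, K)\<in>\<D>. f (\<gamma> t) * (\<gamma> (Sup K) - \<gamma> (Inf K))) - contour_integral p f) < \<epsilon>" .
  qed (rule \<delta>(1))
qed

text \<open>
  A polynomial path \<open>p\<close> close to \<open>\<gamma>\<close> is homotopic to it in \<open>D - {w}\<close>, hence has the same winding
  numbers about \<open>w\<close> and about the points outside \<open>D\<close>: \<open>1\<close> and \<open>0\<close>. The residue theorem for \<open>p\<close>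
  therefore evaluates the integral along \<open>\<gamma>\<close>.
\<close>

lemma line_integral_jordan_contour:
  assumes D: "open D" "connected D" and \<gamma>: "jordan_contour D w \<gamma>" 
    and F: "F holomorphic_on D"
  shows "line_integral \<gamma> (\<lambda>t. F t * (\<Sum>m\<le>k. c m / (t - w) ^ Suc m)) =
     2 * of_real pi * \<i> * (\<Sum>m\<le>k. c m * (deriv ^^ m) F w / fact m)"
proof -
  define V where "V = D - {w}"
  have V: "open V" using D by (simp add: V_def open_delete)
  have rect: "rectifiable_path \<gamma>" and loop: "pathfinish \<gamma> = pathstart \<gamma>"
    and sub: "path_image \<gamma> \<union> inside (path_image \<gamma>) \<subseteq> D"
    and w: "w \<in> inside (path_image \<gamma>)" "winding_number \<gamma> w = 1"
    using \<gamma> by (auto simp: jordan_contour_def)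
  have path: "path \<gamma>" using rect by (simp add: rectifiable_path_def)
  have wD: "w \<in> D" and w_off: "w \<notin> path_image \<gamma>"
    using w(1) sub inside_no_overlap by blast+
  have im: "path_image \<gamma> \<subseteq> V" using sub w_off by (auto simp: V_def)
  obtain r where r: "r > 0" "(\<Union>z\<in>path_image \<gamma>. ball z r) \<subseteq> V"
    using compact_subset_open_imp_ball_epsilon_subset[OF compact_path_image[OF path] V im] by blast
  obtain p where p: "polynomial_function p" "pathstart p = pathstart \<gamma>" "pathfinish p = pathfinish \<gamma>"
      "\<And>t. t \<in> {0..1} \<Longrightarrow> norm (p t - \<gamma> t) < r / 2"
    using path_approx_polynomial_function[OF path, of "r / 2"] r(1) by auto
  have vp: "valid_path p" using p(1) by (rule valid_path_polynomial_function)
  have hom: "homotopic_loops V \<gamma> p"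
  proof (rule homotopic_loops_nearby_explicit)
    fix t z assume t: "t \<in> {0..1::real}" and z: "z \<notin> V"
    have "\<not> dist (\<gamma> t) z < r" using r(2) t z by (fastforce simp: path_image_def)
    then show "norm (p t - \<gamma> t) < norm (\<gamma> t - z)" using p(4)[OF t] r(1) by (simp add: dist_norm)
  qed (use path vp loop p in \<open>auto intro: valid_path_imp_path\<close>)
  have wind: "winding_number p z = winding_number \<gamma> z" if "z \<notin> V" for z
  proof -
    have "homotopic_loops (- {z}) \<gamma> p"
      using hom that by (elim homotopic_loops_subset) auto
    then show ?thesis by (simp add: winding_number_homotopic_loops)
  qed
  have wind0: "winding_number p z = 0" if "z \<notin> D" for z
  proof -
    have "z \<in> outside (path_image \<gamma>)"
      using that sub inside_Un_outside[of "path_image \<gamma>"] by blast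
    then show ?thesis
      using wind[of z] that winding_number_zero_in_outside[OF path loop] by (simp add: V_def)
  qed
  let ?h = "\<lambda>m t. F t / (t - w) ^ Suc m"
  have hol: "?h m holomorphic_on V" for m
    unfolding V_def by (intro holomorphic_intros holomorphic_on_subset[OF F]) auto
  have pV: "path_image p \<subseteq> V" using homotopic_loops_imp_subset[OF hom] by auto
  have "contour_integral p (?h m) = 2 * of_real pi * \<i> * ((deriv ^^ m) F w / fact m)" for m
  proof -
    have "contour_integral p (?h m) = 2 * of_real pi * \<i> * (\<Sum>z\<in>{w}. winding_number p z * residue (?h m) z)"
      using Residue_theorem[of D "{w}" "?h m" p] D vp p(2,3) loop pV hol[of m] wind0
      by (simp add: V_def)
    also have "\<dots> = 2 * of_real pi * \<i> * ((deriv ^^ m) F w / fact m)"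
      using wind[of w] w(2) residue_holomorphic_over_power[OF D(1) wD F, of m] by (simp add: V_def)
    finally show ?thesis .
  qed
  then have int: "(?h m has_contour_integral 2 * of_real pi * \<i> * ((deriv ^^ m) F w / fact m)) p" for m
    using contour_integrable_holomorphic_simple[OF hol[of m] V vp pV] has_contour_integral_integral
    by metis
  let ?f = "\<lambda>t. F t * (\<Sum>m\<le>k. c m / (t - w) ^ Suc m)"
  have f_eq: "?f = (\<lambda>t. \<Sum>m\<le>k. c m * ?h m t)"
    by (simp add: sum_distrib_left mult_ac)
  have "(?f has_contour_integral (\<Sum>m\<le>k. c m * (2 * of_real pi * \<i> * ((deriv ^^ m) F w / fact m)))) p"
    unfolding f_eq by (intro has_contour_integral_sum has_contour_integral_lmul int) auto
  then have int_f: "contour_integral p ?f = 2 * of_real pi * \<i> * (\<Sum>m\<le>k. c m * (deriv ^^ m) F w / fact m)"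
    by (simp add: contour_integral_unique sum_distrib_left mult_ac)
  have "has_line_integral ?f (contour_integral p ?f) \<gamma>"
  proof (rule has_line_integral_nearby_path[OF rect _ V vp p(2,3) r(1) _ p(4)])
    show "?f holomorphic_on V"
      unfolding f_eq by (intro holomorphic_intros hol)
    show "ball (\<gamma> t) r \<subseteq> V" if "t \<in> {0..1}" for t
      using r(2) that by (fastforce simp: path_image_def)
  qed
  from line_integral_unique[OF this] int_f show ?thesis by (rule trans)
qed

section \<open>The algebra of coefficient sequences\<close>

lemma finite_multi_indices: "finite (multi_indices p :: ('d::finite \<Rightarrow> nat) set)"
proof (rule finite_subset)
  show "multi_indices p \<subseteq> (UNIV :: 'd set) \<rightarrow>\<^sub>E {..p}"
  proof
    fix \<alpha> :: "'d \<Rightarrow> nat" assume \<alpha>: "\<alpha> \<in> multi_indices p"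
    have "\<alpha> j \<le> p" for j
      using \<alpha> member_le_sum[of j UNIV \<alpha>] by (simp add: multi_indices_def)
    then show "\<alpha> \<in> UNIV \<rightarrow>\<^sub>E {..p}" by auto
  qed
qed (simp add: finite_PiE)

lemma (in cring) foldr_mult_replicate:
  assumes "\<And>j. e j \<in> carrier R" "v \<in> carrier R"
  shows "foldr (\<lambda>j v. e j \<otimes> v) (replicate m i) v = e i [^] m \<otimes> v"
  using assms by (induction m) (auto simp: m_ac)

lemma (in cring) foldr_mult_monomial:
  assumes e: "\<And>j. e j \<in> carrier R" and v: "v \<in> carrier R" and "distinct l"
  shows "foldr (\<lambda>j v. e j \<otimes> v) (concat (map (\<lambda>j. replicate (\<alpha> j) j) l)) v
    = (\<Otimes>j\<in>set l. e j [^] (\<alpha> j :: nat)) \<otimes> v"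
  using \<open>distinct l\<close>
proof (induction l)
  case Nil
  then show ?case using v by simp
next
  case (Cons i l)
  have "(\<Otimes>j\<in>set l. e j [^] \<alpha> j) \<in> carrier R" using e by auto
  with Cons show ?case
    using foldr_mult_replicate[of e _ "\<alpha> i" i] e v by (simp add: m_assoc)
qed

text \<open>The table \<open>\<Upsilon>\<close> covers only the products of non-unit basis elements; the unit has index \<open>0\<close>.\<close>

definition struct_const :: "(nat \<Rightarrow> nat \<Rightarrow> nat \<Rightarrow> complex) \<Rightarrow> nat \<Rightarrow> nat \<Rightarrow> nat \<Rightarrow> complex" where
  "struct_const \<Upsilon> r s k =
    (if r = 0 then of_bool (k = s) else if s = 0 then of_bool (k = r) else \<Upsilon> r s k)"

definition seq_mult ::
    "(nat \<Rightarrow> nat \<Rightarrow> nat \<Rightarrow> complex) \<Rightarrow> (nat \<Rightarrow> complex) \<Rightarrow> (nat \<Rightarrow> complex) \<Rightarrow> nat \<Rightarrow> complex" where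
  "seq_mult \<Upsilon> u v k = (\<Sum>r\<le>k. \<Sum>s\<le>k. u r * v s * struct_const \<Upsilon> r s k)"

definition seq_one :: "nat \<Rightarrow> complex" where "seq_one k = of_bool (k = 0)"

lemma seq_mult_cong:
  "(\<And>r. r \<le> k \<Longrightarrow> v r = w r) \<Longrightarrow> seq_mult \<Upsilon> u v k = seq_mult \<Upsilon> u w k"
  unfolding seq_mult_def by (intro sum.cong) auto

lemma seq_mult_add_left:
  "seq_mult \<Upsilon> (\<lambda>k. u k + v k) w k = seq_mult \<Upsilon> u w k + seq_mult \<Upsilon> v w k"
  by (simp add: seq_mult_def sum.distrib[symmetric] algebra_simps)

lemma seq_mult_scale_left:
  "seq_mult \<Upsilon> (\<lambda>k. c * u k) w k = c * seq_mult \<Upsilon> u w k"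
  by (simp add: seq_mult_def sum_distrib_left algebra_simps)

lemma seq_mult_scale_right:
  "seq_mult \<Upsilon> w (\<lambda>k. c * u k) k = c * seq_mult \<Upsilon> w u k"
  by (simp add: seq_mult_def sum_distrib_left algebra_simps)

lemma seq_mult_sum_right:
  "seq_mult \<Upsilon> w (\<lambda>k. \<Sum>i\<in>A. f i k) k = (\<Sum>i\<in>A. seq_mult \<Upsilon> w (f i) k)"
proof (induction A rule: infinite_finite_induct)
  case (insert i A)
  have "seq_mult \<Upsilon> w (\<lambda>k. f i k + (\<Sum>j\<in>A. f j k)) k
      = seq_mult \<Upsilon> w (f i) k + seq_mult \<Upsilon> w (\<lambda>k. \<Sum>j\<in>A. f j k) k"
    by (simp add: seq_mult_def sum.distrib[symmetric] algebra_simps)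
  with insert show ?case by simp
qed (simp_all add: seq_mult_def)

lemma seq_mult_zero_left [simp]: "seq_mult \<Upsilon> (\<lambda>_. 0) v k = 0"
  and seq_mult_zero_right [simp]: "seq_mult \<Upsilon> u (\<lambda>_. 0) k = 0"
  by (simp_all add: seq_mult_def)

lemma seq_mult_one_left: "seq_mult \<Upsilon> seq_one v = v"
proof
  fix k
  have "seq_mult \<Upsilon> seq_one v k = (\<Sum>r\<le>k. if r = 0 then \<Sum>s\<le>k. v s * of_bool (k = s) else 0)"
    unfolding seq_mult_def by (intro sum.cong) (auto simp: seq_one_def struct_const_def)
  also have "\<dots> = v k" by (simp add: sum.delta' of_bool_def if_distrib[of "\<lambda>x. v _ * x"] cong: if_cong)
  finally show "seq_mult \<Upsilon> seq_one v k = v k" .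
qed

lemma complex_ring_simps [simp]:
  "x \<in> carrier complex_ring" "x \<otimes>\<^bsub>complex_ring\<^esub> y = x * y" "x \<oplus>\<^bsub>complex_ring\<^esub> y = x + y"
  "\<one>\<^bsub>complex_ring\<^esub> = 1" "\<zero>\<^bsub>complex_ring\<^esub> = 0"
  by (auto simp: complex_ring_def)

text \<open>
  Truncation is a homomorphism from sequences to \<open>E n\<close> that loses only the coefficients from
  \<open>n\<close> on (\<open>trunc_mult\<close>, \<open>trunc_inject\<close>). An identity between \<open>k\<close>-th coefficients of sequences
  therefore follows from the identity in \<open>E n\<close> for one \<open>n > k\<close>.
\<close>

locale extension_seq =
  fixes E :: "nat \<Rightarrow> (complex, 'e) module" and I :: "nat \<Rightarrow> nat \<Rightarrow> 'e"
    and \<Upsilon> :: "nat \<Rightarrow> nat \<Rightarrow> nat \<Rightarrow> complex"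
  assumes ext: "extension_sequence E I \<Upsilon>"
begin

text \<open>
  The two vanishing rules make the coefficients of a product depend only on coefficients of lower
  or equal index. The second one, for non-unit factors, is the source of nilpotency.
\<close>

lemma struct_const_eq_0:
  assumes "k < max r s" shows "struct_const \<Upsilon> r s k = 0"
  using assms ext by (auto simp: struct_const_def extension_sequence_def)

lemma struct_const_eq_0':
  assumes "k \<le> max r s" "r \<noteq> 0" "s \<noteq> 0" shows "struct_const \<Upsilon> r s k = 0"
  using assms ext by (auto simp: struct_const_def extension_sequence_def)

abbreviation trunc :: "nat \<Rightarrow> (nat \<Rightarrow> complex) \<Rightarrow> 'e" where
  "trunc n u \<equiv> lin_comb (E n) (I n) u n"

context
  fixes n :: nat
  assumes n: "n \<ge> 2"
begin

lemma algebra_E: "Module.algebra complex_ring (E n)"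
  using ext n by (simp add: extension_sequence_def)

interpretation A: Module.algebra complex_ring "E n" by (rule algebra_E)

lemma smult_E:
  assumes "x \<in> carrier (E n)"
  shows "c \<odot>\<^bsub>E n\<^esub> x \<in> carrier (E n)"
    and "(b + c) \<odot>\<^bsub>E n\<^esub> x = b \<odot>\<^bsub>E n\<^esub> x \<oplus>\<^bsub>E n\<^esub> c \<odot>\<^bsub>E n\<^esub> x"
    and "(b * c) \<odot>\<^bsub>E n\<^esub> x = b \<odot>\<^bsub>E n\<^esub> (c \<odot>\<^bsub>E n\<^esub> x)"
    and "1 \<odot>\<^bsub>E n\<^esub> x = x"
    and "0 \<odot>\<^bsub>E n\<^esub> x = \<zero>\<^bsub>E n\<^esub>"
  using A.smult_closed[of c x] A.smult_l_distr[of b c x] A.smult_assoc1[of b c x]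
    A.smult_one[of x] A.smult_l_null[of x] assms by simp_all

lemma I_closed: "r < n \<Longrightarrow> I n r \<in> carrier (E n)"
  using ext n by (auto simp: extension_sequence_def is_basis_def Pi_def)

lemma trunc_closed: "trunc n u \<in> carrier (E n)"
  unfolding lin_comb_def by (intro A.M.finsum_closed) (auto intro: I_closed)

lemma trunc_cong: "(\<And>k. k < n \<Longrightarrow> u k = v k) \<Longrightarrow> trunc n u = trunc n v"
  unfolding lin_comb_def by (intro A.M.finsum_cong') (auto intro: I_closed)

lemma trunc_inject:
  assumes "trunc n u = trunc n v" "k < n"
  shows "u k = v k"
proof -
  let ?u = "restrict u {..<n}" and ?v = "restrict v {..<n}"
  have "\<exists>!c. c \<in> {..<n} \<rightarrow>\<^sub>E UNIV \<and> trunc n u = trunc n c"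
    using ext n trunc_closed[of u] by (simp add: extension_sequence_def is_basis_def)
  moreover have "trunc n u = trunc n ?u" "trunc n v = trunc n ?v"
    by (auto intro: trunc_cong)
  moreover have "?u \<in> {..<n} \<rightarrow>\<^sub>E UNIV" "?v \<in> {..<n} \<rightarrow>\<^sub>E UNIV" by auto
  ultimately have "?u = ?v" using assms(1) by (metis (no_types, lifting))
  then show ?thesis using assms(2) by (metis lessThan_iff restrict_apply')
qed

lemma trunc_add: "trunc n (\<lambda>k. u k + v k) = trunc n u \<oplus>\<^bsub>E n\<^esub> trunc n v"
proof -
  have "trunc n (\<lambda>k. u k + v k) = (\<Oplus>\<^bsub>E n\<^esub>r\<in>{..<n}. u r \<odot>\<^bsub>E n\<^esub> I n r \<oplus>\<^bsub>E n\<^esub> v r \<odot>\<^bsub>E n\<^esub> I n r)"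
    unfolding lin_comb_def
    by (intro A.M.finsum_cong') (auto simp: smult_E I_closed)
  then show ?thesis
    unfolding lin_comb_def by (subst A.M.finsum_addf[symmetric]) (auto intro: I_closed)
qed

lemma trunc_scale: "trunc n (\<lambda>k. c * u k) = c \<odot>\<^bsub>E n\<^esub> trunc n u"
  unfolding lin_comb_def
  by (subst A.finsum_smult_ldistr) (auto simp: smult_E I_closed intro!: A.M.finsum_cong')

lemma trunc_zero: "trunc n (\<lambda>k. 0) = \<zero>\<^bsub>E n\<^esub>"
  using trunc_scale[of 0 "\<lambda>_. 0"] A.smult_l_null[OF trunc_closed] by simp

lemma trunc_sum:
  "finite S \<Longrightarrow> trunc n (\<lambda>k. \<Sum>i\<in>S. f i k) = (\<Oplus>\<^bsub>E n\<^esub>i\<in>S. trunc n (f i))"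
  by (induction S rule: finite_induct) (auto simp: trunc_zero trunc_add trunc_closed)

lemma basis_mult:
  assumes "r < n" "s < n"
  shows "I n r \<otimes>\<^bsub>E n\<^esub> I n s = trunc n (struct_const \<Upsilon> r s)"
proof -
  have I0: "I n 0 = \<one>\<^bsub>E n\<^esub>" using ext n by (simp add: extension_sequence_def)
  have unit: "trunc n (\<lambda>k. of_bool (k = m)) = I n m" if "m < n" for m
  proof -
    have "trunc n (\<lambda>k. of_bool (k = m)) =
        (\<Oplus>\<^bsub>E n\<^esub>r\<in>{..<n}. if m = r then I n r else \<zero>\<^bsub>E n\<^esub>)"
      unfolding lin_comb_def by (intro A.M.finsum_cong') (auto simp: smult_E I_closed)
    then show ?thesis
      using A.M.finsum_singleton[of m "{..<n}" "I n"] that by (auto intro: I_closed)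
  qed
  consider "r = 0" | "r \<noteq> 0" "s = 0" | "r \<noteq> 0" "s \<noteq> 0" by blast
  then show ?thesis
  proof cases
    case 1
    then have "struct_const \<Upsilon> r s = (\<lambda>k. of_bool (k = s))" by (auto simp: struct_const_def)
    then show ?thesis using 1 I0 unit assms I_closed by simp
  next
    case 2
    then have "struct_const \<Upsilon> r s = (\<lambda>k. of_bool (k = r))" by (auto simp: struct_const_def)
    then show ?thesis using 2 I0 unit assms I_closed by simp
  next
    case 3
    have "r \<in> {1..n-1}" "s \<in> {1..n-1}" using 3 assms by auto
    then have "I n r \<otimes>\<^bsub>E n\<^esub> I n s = (\<Oplus>\<^bsub>E n\<^esub>k\<in>{max r s + 1..n-1}. \<Upsilon> r s k \<odot>\<^bsub>E n\<^esub> I n k)"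
      using ext n by (simp add: extension_sequence_def)
    also have "\<dots> = trunc n (struct_const \<Upsilon> r s)"
      unfolding lin_comb_def
    proof (rule A.M.add.finprod_mono_neutral_cong_left)
      fix k assume "k \<in> {..<n} - {max r s + 1..n - 1}"
      then have "struct_const \<Upsilon> r s k = 0" "k < n" using 3 by (auto intro!: struct_const_eq_0')
      then show "struct_const \<Upsilon> r s k \<odot>\<^bsub>E n\<^esub> I n k = \<zero>\<^bsub>E n\<^esub>"
        using A.smult_l_null[OF I_closed] by simp
    qed (use n 3 in \<open>auto simp: struct_const_def intro: I_closed\<close>)
    finally show ?thesis .
  qed
qed

lemma trunc_mult: "trunc n (seq_mult \<Upsilon> u v) = trunc n u \<otimes>\<^bsub>E n\<^esub> trunc n v"
proof -
  have mult_basis: "(u r \<odot>\<^bsub>E n\<^esub> I n r) \<otimes>\<^bsub>E n\<^esub> (v s \<odot>\<^bsub>E n\<^esub> I n s)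
      = trunc n (\<lambda>k. u r * v s * struct_const \<Upsilon> r s k)" if "r < n" "s < n" for r s
  proof -
    note cl = I_closed[OF that(1)] I_closed[OF that(2)]
    have "(u r \<odot>\<^bsub>E n\<^esub> I n r) \<otimes>\<^bsub>E n\<^esub> (v s \<odot>\<^bsub>E n\<^esub> I n s)
        = u r \<odot>\<^bsub>E n\<^esub> (I n r \<otimes>\<^bsub>E n\<^esub> (v s \<odot>\<^bsub>E n\<^esub> I n s))"
      using cl by (intro A.smult_assoc2) auto
    also have "I n r \<otimes>\<^bsub>E n\<^esub> (v s \<odot>\<^bsub>E n\<^esub> I n s) = (v s \<odot>\<^bsub>E n\<^esub> I n s) \<otimes>\<^bsub>E n\<^esub> I n r"
      using cl by (intro A.m_comm) auto
    also have "\<dots> = v s \<odot>\<^bsub>E n\<^esub> (I n s \<otimes>\<^bsub>E n\<^esub> I n r)"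
      using cl by (intro A.smult_assoc2) auto
    also have "I n s \<otimes>\<^bsub>E n\<^esub> I n r = I n r \<otimes>\<^bsub>E n\<^esub> I n s"
      using cl by (intro A.m_comm) auto
    also have "u r \<odot>\<^bsub>E n\<^esub> (v s \<odot>\<^bsub>E n\<^esub> (I n r \<otimes>\<^bsub>E n\<^esub> I n s))
        = (u r * v s) \<odot>\<^bsub>E n\<^esub> (I n r \<otimes>\<^bsub>E n\<^esub> I n s)"
      using cl A.smult_assoc1[of "u r" "v s" "I n r \<otimes>\<^bsub>E n\<^esub> I n s"] by simp
    finally show ?thesis using that by (simp add: basis_mult trunc_scale)
  qed
  have "trunc n u \<otimes>\<^bsub>E n\<^esub> trunc n v =
      (\<Oplus>\<^bsub>E n\<^esub>r\<in>{..<n}. (u r \<odot>\<^bsub>E n\<^esub> I n r) \<otimes>\<^bsub>E n\<^esub> trunc n v)"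
    unfolding lin_comb_def[of _ _ u]
    by (intro A.finsum_ldistr) (auto intro: I_closed trunc_closed)
  also have "\<dots> = (\<Oplus>\<^bsub>E n\<^esub>r\<in>{..<n}. \<Oplus>\<^bsub>E n\<^esub>s\<in>{..<n}. (u r \<odot>\<^bsub>E n\<^esub> I n r) \<otimes>\<^bsub>E n\<^esub> (v s \<odot>\<^bsub>E n\<^esub> I n s))"
    unfolding lin_comb_def[of _ _ v]
    by (intro A.M.finsum_cong' A.finsum_rdistr) (auto intro!: A.M.finsum_closed smult_E I_closed)
  also have "\<dots> = (\<Oplus>\<^bsub>E n\<^esub>r\<in>{..<n}. \<Oplus>\<^bsub>E n\<^esub>s\<in>{..<n}. trunc n (\<lambda>k. u r * v s * struct_const \<Upsilon> r s k))"
    by (intro A.M.finsum_cong') (auto simp: mult_basis intro!: A.M.finsum_closed trunc_closed)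
  also have "\<dots> = trunc n (\<lambda>k. \<Sum>r<n. \<Sum>s<n. u r * v s * struct_const \<Upsilon> r s k)"
    by (simp add: trunc_sum)
  also have "\<dots> = trunc n (seq_mult \<Upsilon> u v)"
  proof (rule trunc_cong)
    fix k assume k: "k < n"
    have "seq_mult \<Upsilon> u v k = (\<Sum>r\<le>k. \<Sum>s<n. u r * v s * struct_const \<Upsilon> r s k)"
      unfolding seq_mult_def using k
      by (intro sum.cong sum.mono_neutral_left) (auto simp: struct_const_eq_0)
    also have "\<dots> = (\<Sum>r<n. \<Sum>s<n. u r * v s * struct_const \<Upsilon> r s k)"
      using k by (intro sum.mono_neutral_left) (auto simp: struct_const_eq_0 intro!: sum.neutral)
    finally show "(\<Sum>r<n. \<Sum>s<n. u r * v s * struct_const \<Upsilon> r s k) = seq_mult \<Upsilon> u v k" ..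
  qed
  finally show ?thesis ..
qed

end

lemma seq_mult_commute: "seq_mult \<Upsilon> u v = seq_mult \<Upsilon> v u"
proof
  fix k :: nat
  define n where "n = k + 2"
  have n: "n \<ge> 2" by (simp add: n_def)
  interpret A: Module.algebra complex_ring "E n" by (rule algebra_E[OF n])
  have "trunc n (seq_mult \<Upsilon> u v) = trunc n (seq_mult \<Upsilon> v u)"
    by (simp add: trunc_mult[OF n] A.m_comm[OF trunc_closed[OF n] trunc_closed[OF n]])
  then show "seq_mult \<Upsilon> u v k = seq_mult \<Upsilon> v u k"
    by (rule trunc_inject[OF n]) (simp add: n_def)
qed

lemma seq_mult_assoc: "seq_mult \<Upsilon> (seq_mult \<Upsilon> u v) w = seq_mult \<Upsilon> u (seq_mult \<Upsilon> v w)"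
proof
  fix k :: nat
  define n where "n = k + 2"
  have n: "n \<ge> 2" by (simp add: n_def)
  interpret A: Module.algebra complex_ring "E n" by (rule algebra_E[OF n])
  have "trunc n (seq_mult \<Upsilon> (seq_mult \<Upsilon> u v) w) = trunc n (seq_mult \<Upsilon> u (seq_mult \<Upsilon> v w))"
    by (simp add: trunc_mult[OF n] A.m_assoc trunc_closed[OF n])
  then show "seq_mult \<Upsilon> (seq_mult \<Upsilon> u v) w k = seq_mult \<Upsilon> u (seq_mult \<Upsilon> v w) k"
    by (rule trunc_inject[OF n]) (simp add: n_def)
qed

text \<open>
  The monomials \<open>e\<^sup>\<alpha>\<close> appear here as the operators that multiply by one \<open>e\<^sub>j\<close> after the other, in the
  order of the differentiations in \<^const>\<open>mixed_partial\<close>.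
\<close>

lemma characteristic_equation_seq:
  fixes a :: "'d::{finite,linorder} \<Rightarrow> nat \<Rightarrow> complex"
  assumes char: "characteristic_equation p C E I a"
  shows "(\<Sum>\<alpha>\<in>multi_indices p. of_real (C \<alpha>) *
    foldr (\<lambda>j. seq_mult \<Upsilon> (a j)) (concat (map (\<lambda>j. replicate (\<alpha> j) j) (sorted_list_of_set UNIV))) u k) = 0"
    (is "(\<Sum>\<alpha>\<in>_. _ * foldr ?L (?l \<alpha>) u k) = 0")
proof -
  define n where "n = k + 2"
  have n: "n \<ge> 2" by (simp add: n_def)
  interpret A: Module.algebra complex_ring "E n" by (rule algebra_E[OF n])
  let ?e = "\<lambda>j. trunc n (a j)"
  let ?P = "\<lambda>\<alpha>. \<Otimes>\<^bsub>E n\<^esub>j\<in>UNIV. ?e j [^]\<^bsub>E n\<^esub> \<alpha> j"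
  have e: "?e j \<in> carrier (E n)" for j by (rule trunc_closed[OF n])
  have P: "?P \<alpha> \<in> carrier (E n)" for \<alpha> :: "'d \<Rightarrow> nat"
    using e by (intro A.finprod_closed) auto
  have "trunc n (foldr ?L js u) = foldr (\<lambda>j v. ?e j \<otimes>\<^bsub>E n\<^esub> v) js (trunc n u)" for js
    by (induction js) (simp_all add: trunc_mult[OF n])
  then have monom: "trunc n (foldr ?L (?l \<alpha>) u) = ?P \<alpha> \<otimes>\<^bsub>E n\<^esub> trunc n u" for \<alpha>
    using A.foldr_mult_monomial[of ?e "trunc n u" "sorted_list_of_set UNIV" \<alpha>] e trunc_closed[OF n]
    by simp
  have "trunc n (\<lambda>k. \<Sum>\<alpha>\<in>multi_indices p. of_real (C \<alpha>) * foldr ?L (?l \<alpha>) u k)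
      = (\<Oplus>\<^bsub>E n\<^esub>\<alpha>\<in>multi_indices p. of_real (C \<alpha>) \<odot>\<^bsub>E n\<^esub> (?P \<alpha> \<otimes>\<^bsub>E n\<^esub> trunc n u))"
    by (simp add: trunc_sum[OF n finite_multi_indices] trunc_scale[OF n] monom)
  also have "\<dots> = (\<Oplus>\<^bsub>E n\<^esub>\<alpha>\<in>multi_indices p. (of_real (C \<alpha>) \<odot>\<^bsub>E n\<^esub> ?P \<alpha>) \<otimes>\<^bsub>E n\<^esub> trunc n u)"
    using P trunc_closed[OF n, of u] A.smult_assoc2
    by (intro A.M.finsum_cong') (auto simp: complex_ring_def)
  also have "\<dots> = (\<Oplus>\<^bsub>E n\<^esub>\<alpha>\<in>multi_indices p. of_real (C \<alpha>) \<odot>\<^bsub>E n\<^esub> ?P \<alpha>) \<otimes>\<^bsub>E n\<^esub> trunc n u"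
    using P trunc_closed[OF n, of u]
    by (intro A.finsum_ldistr[symmetric] finite_multi_indices) (auto simp: complex_ring_def)
  also have "\<dots> = \<zero>\<^bsub>E n\<^esub> \<otimes>\<^bsub>E n\<^esub> trunc n u"
    using char n by (simp add: characteristic_equation_def)
  also have "\<dots> = trunc n (\<lambda>k. 0)"
    using trunc_closed[OF n, of u] by (simp add: trunc_zero[OF n])
  finally show ?thesis
    by (rule trunc_inject[OF n]) (simp add: n_def)
qed

end

section \<open>Holomorphic functions on the sequence algebra\<close>

definition seq_pow :: "(nat \<Rightarrow> nat \<Rightarrow> nat \<Rightarrow> complex) \<Rightarrow> (nat \<Rightarrow> complex) \<Rightarrow> nat \<Rightarrow> nat \<Rightarrow> complex" where
  "seq_pow \<Upsilon> u m = (seq_mult \<Upsilon> u ^^ m) seq_one"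

definition nil_part :: "(nat \<Rightarrow> complex) \<Rightarrow> nat \<Rightarrow> complex" where
  "nil_part u = u(0 := 0)"

text \<open>
  The \<open>k\<close>-th coefficient of the principal extension \<open>F(z)\<close> of the holomorphic function \<open>F\<close> to the
  sequence algebra. The Taylor sum may stop at \<open>m = k\<close>, because \<open>N\<^sup>m\<close> has no coefficients
  below \<open>m\<close>.
\<close>

definition hol_ext ::
    "(nat \<Rightarrow> nat \<Rightarrow> nat \<Rightarrow> complex) \<Rightarrow> (complex \<Rightarrow> complex) \<Rightarrow> (nat \<Rightarrow> complex) \<Rightarrow> nat \<Rightarrow> complex" where
  "hol_ext \<Upsilon> F z k = (\<Sum>m\<le>k. (deriv ^^ m) F (z 0) / fact m * seq_pow \<Upsilon> (nil_part z) m k)"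

lemma seq_pow_0 [simp]: "seq_pow \<Upsilon> u 0 = seq_one"
  by (simp add: seq_pow_def)

lemma seq_pow_Suc [simp]: "seq_pow \<Upsilon> u (Suc m) = seq_mult \<Upsilon> u (seq_pow \<Upsilon> u m)"
  by (simp add: seq_pow_def)

lemma seq_mult_nil_part:
  "seq_mult \<Upsilon> c v k = c 0 * v k + seq_mult \<Upsilon> (nil_part c) v k"
proof -
  have "c = (\<lambda>k. c 0 * seq_one k + nil_part c k)"
    by (auto simp: seq_one_def nil_part_def)
  then have "seq_mult \<Upsilon> c v k = seq_mult \<Upsilon> (\<lambda>k. c 0 * seq_one k + nil_part c k) v k"
    by simp
  also have "\<dots> = c 0 * v k + seq_mult \<Upsilon> (nil_part c) v k"
    by (simp add: seq_mult_add_left seq_mult_scale_left seq_mult_one_left)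
  finally show ?thesis .
qed

lemma has_vector_derivative_seq_mult:
  assumes "\<And>k. ((\<lambda>h. u h k) has_vector_derivative u' k) (at x)"
    and "\<And>k. ((\<lambda>h. v h k) has_vector_derivative v' k) (at x)"
  shows "((\<lambda>h. seq_mult \<Upsilon> (u h) (v h) k) has_vector_derivative
    seq_mult \<Upsilon> u' (v x) k + seq_mult \<Upsilon> (u x) v' k) (at x)"
proof -
  have "((\<lambda>h. u h r * v h s * struct_const \<Upsilon> r s k) has_vector_derivative
     (u x r * v' s + u' r * v x s) * struct_const \<Upsilon> r s k) (at x)" for r s
    by (intro has_vector_derivative_mult_left has_vector_derivative_mult assms)
  then have "((\<lambda>h. \<Sum>r\<le>k. \<Sum>s\<le>k. u h r * v h s * struct_const \<Upsilon> r s k) has_vector_derivative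
     (\<Sum>r\<le>k. \<Sum>s\<le>k. (u x r * v' s + u' r * v x s) * struct_const \<Upsilon> r s k)) (at x)"
    by (intro has_vector_derivative_sum)
  then show ?thesis
    by (simp add: seq_mult_def sum.distrib[symmetric] algebra_simps)
qed

lemma has_vector_derivative_foldr_seq_mult:
  assumes "\<And>k. ((\<lambda>h. v h k) has_vector_derivative v' k) (at x)"
  shows "((\<lambda>h. foldr (\<lambda>j. seq_mult \<Upsilon> (a j)) js (v h) k) has_vector_derivative
    foldr (\<lambda>j. seq_mult \<Upsilon> (a j)) js v' k) (at x)"
proof (induction js arbitrary: k)
  case (Cons j js)
  have "((\<lambda>h. seq_mult \<Upsilon> (a j) (foldr (\<lambda>j. seq_mult \<Upsilon> (a j)) js (v h)) k) has_vector_derivative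
     seq_mult \<Upsilon> (\<lambda>_. 0) (foldr (\<lambda>j. seq_mult \<Upsilon> (a j)) js (v x)) k
      + seq_mult \<Upsilon> (a j) (foldr (\<lambda>j. seq_mult \<Upsilon> (a j)) js v') k) (at x)"
    by (intro has_vector_derivative_seq_mult Cons) simp
  then show ?case by simp
qed (simp add: assms)

lemma continuous_on_seq_mult:
  assumes "\<And>k. continuous_on S (\<lambda>x. u x k)" "\<And>k. continuous_on S (\<lambda>x. v x k)"
  shows "continuous_on S (\<lambda>x. seq_mult \<Upsilon> (u x) (v x) k)"
  unfolding seq_mult_def by (intro continuous_intros assms)

lemma continuous_on_seq_pow:
  assumes "\<And>k. continuous_on S (\<lambda>x. u x k)"
  shows "continuous_on S (\<lambda>x. seq_pow \<Upsilon> (u x) m k)"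
  by (induction m arbitrary: k) (auto intro!: continuous_on_seq_mult assms)

lemma xi_axis: "xi a (x + h *\<^sub>R axis j 1) s = xi a x s + of_real h * a j s"
proof -
  have "xi a (x + h *\<^sub>R axis j 1) s = xi a x s + (\<Sum>i\<in>UNIV. of_real h * (if i = j then a i s else 0))"
    unfolding xi_def sum.distrib[symmetric]
    by (intro sum.cong) (auto simp: axis_def algebra_simps)
  then show ?thesis by (simp add: sum_distrib_left[symmetric])
qed

lemma continuous_on_xi: "continuous_on S (\<lambda>x. xi a x s)"
  unfolding xi_def by (intro continuous_intros)

context extension_seq
begin

lemma seq_mult_left_commute:
  "seq_mult \<Upsilon> u (seq_mult \<Upsilon> v w) = seq_mult \<Upsilon> v (seq_mult \<Upsilon> u w)"
  by (metis seq_mult_assoc seq_mult_commute)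

text \<open>
  Each multiplication by \<open>u\<close> raises the index of the first nonzero coefficient, since a product of
  basis elements \<open>I\<^sub>r I\<^sub>s\<close> with \<open>r, s \<ge> 1\<close> involves only indices above both.
\<close>

lemma seq_pow_eq_0:
  assumes "u 0 = 0" "k < m"
  shows "seq_pow \<Upsilon> u m k = 0"
  using assms(2)
proof (induction m arbitrary: k)
  case (Suc m)
  have "u r * seq_pow \<Upsilon> u m s * struct_const \<Upsilon> r s k = 0" if "r \<le> k" "s \<le> k" for r s
  proof (cases "s < m \<or> r = 0")
    case True
    then show ?thesis using Suc.IH assms(1) by auto
  next
    case False
    then have "s = k" "r \<noteq> 0" "s \<noteq> 0" using that Suc.prems by auto
    then show ?thesis using struct_const_eq_0'[of k r s] by simp
  qed
  then have "seq_mult \<Upsilon> u (seq_pow \<Upsilon> u m) k = 0"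
    unfolding seq_mult_def by (intro sum.neutral ballI) simp
  then show ?case by simp
qed simp

lemma hol_ext_eq:
  assumes "k \<le> M"
  shows "hol_ext \<Upsilon> F z k = (\<Sum>m\<le>M. (deriv ^^ m) F (z 0) / fact m * seq_pow \<Upsilon> (nil_part z) m k)"
  unfolding hol_ext_def using assms
  by (intro sum.mono_neutral_left) (auto simp: seq_pow_eq_0 nil_part_def)

lemma seq_mult_nilpotent_Suc:
  assumes "u 0 = 0"
  shows "seq_mult \<Upsilon> v u (Suc k) = v 0 * u (Suc k) + (\<Sum>r\<in>{1..k}. v r * (\<Sum>s\<in>{1..k}. u s * \<Upsilon> r s (Suc k)))"
proof -
  let ?g = "\<lambda>r. \<Sum>s\<le>Suc k. v r * u s * struct_const \<Upsilon> r s (Suc k)"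
  have "seq_mult \<Upsilon> v u (Suc k) = (\<Sum>r\<in>insert 0 {1..k}. ?g r)"
    unfolding seq_mult_def
  proof (rule sum.mono_neutral_right)
    have "v (Suc k) * u s * struct_const \<Upsilon> (Suc k) s (Suc k) = 0" for s
      using assms struct_const_eq_0'[of "Suc k" "Suc k" s] by (cases "s = 0") auto
    then have "?g (Suc k) = 0" by (intro sum.neutral ballI)
    moreover have "r = Suc k" if "r \<in> {..Suc k} - insert 0 {1..k}" for r using that by auto
    ultimately show "\<forall>r\<in>{..Suc k} - insert 0 {1..k}. ?g r = 0" by blast
  qed auto
  also have "\<dots> = ?g 0 + (\<Sum>r\<in>{1..k}. ?g r)" by simp
  also have "?g 0 = (\<Sum>s\<le>Suc k. if s = Suc k then v 0 * u (Suc k) else 0)"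
    by (intro sum.cong) (auto simp: struct_const_def)
  also have "\<dots> = v 0 * u (Suc k)" by simp
  also have "(\<Sum>r\<in>{1..k}. ?g r) = (\<Sum>r\<in>{1..k}. v r * (\<Sum>s\<in>{1..k}. u s * \<Upsilon> r s (Suc k)))"
  proof (rule sum.cong)
    fix r assume r: "r \<in> {1..k}"
    have "?g r = (\<Sum>s\<in>{1..k}. v r * u s * struct_const \<Upsilon> r s (Suc k))"
      using r assms struct_const_eq_0'[of "Suc k" r "Suc k"]
      by (intro sum.mono_neutral_right) (auto simp: not_le le_Suc_eq)
    also have "\<dots> = v r * (\<Sum>s\<in>{1..k}. u s * \<Upsilon> r s (Suc k))"
      unfolding sum_distrib_left using r by (intro sum.cong) (auto simp: struct_const_def)
    finally show "?g r = v r * (\<Sum>s\<in>{1..k}. u s * \<Upsilon> r s (Suc k))" .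
  qed simp
  finally show ?thesis .
qed

text \<open>
  The geometric series \<open>R = (\<Sum>m. N\<^sup>m / \<tau>\<^bsup>m+1\<^esup>)\<close> with \<open>\<tau> = t - \<xi>\<close> satisfies \<open>\<tau> R = 1 + N R\<close>. Its
  \<open>k\<close>-th coefficient is the recursion of \<^const>\<open>A_coeff\<close>, in which \<open>R\<close> enters only with indices
  below \<open>k\<close>.
\<close>

lemma A_coeff_eq_sum_seq_pow:
  "A_coeff \<Upsilon> z t k = (\<Sum>m\<le>k. seq_pow \<Upsilon> (nil_part z) m k / (t - z 0) ^ Suc m)"
proof (induction k rule: less_induct)
  case (less k)
  let ?N = "nil_part z" and ?\<tau> = "t - z 0"
  have N0: "?N 0 = 0" by (simp add: nil_part_def)
  show ?case
  proof (cases k)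
    case 0
    then show ?thesis by (simp add: seq_one_def)
  next
    case (Suc l)
    define G where "G = (\<lambda>i. \<Sum>m\<le>l. (1 / ?\<tau> ^ Suc m) * seq_pow \<Upsilon> ?N m i)"
    have G: "G i = A_coeff \<Upsilon> z t i" if "i \<le> l" for i
    proof -
      have "G i = (\<Sum>m\<le>i. (1 / ?\<tau> ^ Suc m) * seq_pow \<Upsilon> ?N m i)"
        unfolding G_def using that by (intro sum.mono_neutral_right) (auto simp: seq_pow_eq_0 N0)
      also have "\<dots> = A_coeff \<Upsilon> z t i" using less.IH[of i] that Suc by simp
      finally show ?thesis .
    qed
    have "(\<Sum>m\<le>k. seq_pow \<Upsilon> ?N m k / ?\<tau> ^ Suc m) =
        (\<Sum>m\<le>l. seq_mult \<Upsilon> ?N (seq_pow \<Upsilon> ?N m) k / ?\<tau> ^ Suc (Suc m))"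
      unfolding Suc sum.atMost_Suc_shift by (simp add: seq_one_def)
    also have "\<dots> = 1 / ?\<tau> * (\<Sum>m\<le>l. (1 / ?\<tau> ^ Suc m) * seq_mult \<Upsilon> ?N (seq_pow \<Upsilon> ?N m) k)"
      by (simp add: sum_distrib_left)
    also have "\<dots> = 1 / ?\<tau> * seq_mult \<Upsilon> ?N G k"
      unfolding G_def seq_mult_sum_right seq_mult_scale_right ..
    also have "seq_mult \<Upsilon> ?N G k = seq_mult \<Upsilon> G ?N k"
      by (simp add: seq_mult_commute)
    also have "\<dots> = G 0 * ?N k + (\<Sum>r\<in>{1..l}. G r * (\<Sum>s\<in>{1..l}. ?N s * \<Upsilon> r s k))"
      unfolding Suc by (rule seq_mult_nilpotent_Suc) (rule N0)
    also have "\<dots> = 1 / ?\<tau> * z k + (\<Sum>r\<in>{1..l}. A_coeff \<Upsilon> z t r * B_coeff \<Upsilon> z r k)"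
      using G by (simp add: B_coeff_def nil_part_def Suc)
    finally show ?thesis
      by (cases l) (auto simp: Suc power2_eq_square distrib_left)
  qed
qed

lemma has_vector_derivative_seq_pow:
  assumes "\<And>k. ((\<lambda>h. u h k) has_vector_derivative w k) (at x)"
  shows "((\<lambda>h. seq_pow \<Upsilon> (u h) m k) has_vector_derivative
    of_nat m * seq_mult \<Upsilon> w (seq_pow \<Upsilon> (u x) (m - 1)) k) (at x)"
proof (induction m arbitrary: k)
  case (Suc m)
  let ?p = "seq_pow \<Upsilon> (u x)"
  have "((\<lambda>h. seq_mult \<Upsilon> (u h) (seq_pow \<Upsilon> (u h) m) k) has_vector_derivative
    seq_mult \<Upsilon> w (?p m) k + seq_mult \<Upsilon> (u x) (\<lambda>k. of_nat m * seq_mult \<Upsilon> w (?p (m - 1)) k) k) (at x)"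
    by (rule has_vector_derivative_seq_mult[OF assms Suc])
  moreover have "seq_mult \<Upsilon> (u x) (\<lambda>k. of_nat m * seq_mult \<Upsilon> w (?p (m - 1)) k) k
      = of_nat m * seq_mult \<Upsilon> w (?p m) k"
    by (cases m) (auto simp: seq_mult_scale_right seq_mult_left_commute[of "u x" w])
  ultimately show ?case by (simp add: algebra_simps)
qed simp

text \<open>
  The chain rule. With \<open>z' = c\<close> and \<open>c = c\<^sub>0 + c'\<close>, the derivative of \<open>F\<^bsup>(m)\<^esup>(\<xi>)\<close> supplies the part
  \<open>c\<^sub>0 F'(z)\<close>, and the derivative of \<open>N\<^sup>m\<close>, after a shift of \<open>m\<close> by one, the part \<open>c' F'(z)\<close>.
\<close>

lemma has_vector_derivative_hol_ext:
  assumes F: "F holomorphic_on D" "open D" and zD: "z x 0 \<in> D"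
    and z: "\<And>k. ((\<lambda>h. z h k) has_vector_derivative c k) (at x)"
  shows "((\<lambda>h. hol_ext \<Upsilon> F (z h) k) has_vector_derivative
    seq_mult \<Upsilon> c (hol_ext \<Upsilon> (deriv F) (z x)) k) (at x)"
proof -
  let ?p = "seq_pow \<Upsilon> (nil_part (z x))" and ?D = "\<lambda>m. (deriv ^^ m) F (z x 0)"
  have swap: "(deriv ^^ m) (deriv F) = (deriv ^^ Suc m) F" for m
    by (metis funpow_Suc_right o_apply)
  have nil: "((\<lambda>h. nil_part (z h) i) has_vector_derivative nil_part c i) (at x)" for i
    using z by (cases "i = 0") (auto simp: nil_part_def)
  have D_deriv: "((\<lambda>h. (deriv ^^ m) F (z h 0)) has_vector_derivative c 0 * ?D (Suc m)) (at x)" for m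
  proof -
    have "((deriv ^^ m) F has_field_derivative deriv ((deriv ^^ m) F) (z x 0)) (at (z x 0))"
      using F zD by (intro holomorphic_derivI[OF holomorphic_higher_deriv]) auto
    from field_vector_diff_chain_at[OF z[of 0] this] show ?thesis by (simp add: o_def)
  qed
  \<comment> \<open>The Taylor sum is taken one term too far, so that the shifted sum runs up to \<open>k\<close>.\<close>
  have "((\<lambda>h. \<Sum>m\<le>Suc k. (deriv ^^ m) F (z h 0) / fact m * seq_pow \<Upsilon> (nil_part (z h)) m k)
      has_vector_derivative
      (\<Sum>m\<le>Suc k. ?D m / fact m * (of_nat m * seq_mult \<Upsilon> (nil_part c) (?p (m - 1)) k)
         + c 0 * ?D (Suc m) / fact m * ?p m k)) (at x)"
    by (intro has_vector_derivative_sum has_vector_derivative_mult has_vector_derivative_divide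
        has_vector_derivative_seq_pow nil D_deriv)
  moreover have "(\<lambda>h. \<Sum>m\<le>Suc k. (deriv ^^ m) F (z h 0) / fact m * seq_pow \<Upsilon> (nil_part (z h)) m k)
      = (\<lambda>h. hol_ext \<Upsilon> F (z h) k)"
    by (simp only: hol_ext_eq[OF le_SucI[OF order_refl]])
  moreover have "(\<Sum>m\<le>Suc k. c 0 * ?D (Suc m) / fact m * ?p m k) = c 0 * hol_ext \<Upsilon> (deriv F) (z x) k"
    unfolding hol_ext_eq[OF le_SucI[OF order_refl]] sum_distrib_left swap
    by (simp only: mult.assoc times_divide_eq_right times_divide_eq_left)
  moreover have "(\<Sum>m\<le>Suc k. ?D m / fact m * (of_nat m * seq_mult \<Upsilon> (nil_part c) (?p (m - 1)) k))
      = seq_mult \<Upsilon> (nil_part c) (hol_ext \<Upsilon> (deriv F) (z x)) k"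
  proof -
    have "(\<Sum>m\<le>Suc k. ?D m / fact m * (of_nat m * seq_mult \<Upsilon> (nil_part c) (?p (m - 1)) k))
        = (\<Sum>m\<le>k. ?D (Suc m) / fact (Suc m) * (of_nat (Suc m) * seq_mult \<Upsilon> (nil_part c) (?p m) k))"
      unfolding sum.atMost_Suc_shift by simp
    also have "\<dots> = (\<Sum>m\<le>k. seq_mult \<Upsilon> (nil_part c) (\<lambda>i. ?D (Suc m) / fact m * ?p m i) k)"
      unfolding seq_mult_scale_right by (intro sum.cong) (auto simp: field_simps simp del: of_nat_Suc)
    also have "\<dots> = seq_mult \<Upsilon> (nil_part c) (\<lambda>i. \<Sum>m\<le>k. ?D (Suc m) / fact m * ?p m i) k"
      by (rule seq_mult_sum_right[symmetric])
    also have "\<dots> = seq_mult \<Upsilon> (nil_part c) (hol_ext \<Upsilon> (deriv F) (z x)) k"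
      by (rule seq_mult_cong) (simp only: hol_ext_eq swap)
    finally show ?thesis .
  qed
  ultimately show ?thesis
    by (simp only: sum.distrib seq_mult_nil_part[of _ c] add.commute)
qed

section \<open>Solutions of the differential equation\<close>

text \<open>
  The chain rule applies again to the result, because multiplication by constants commutes with
  differentiation and the factors \<open>e\<^sub>j\<close> commute with each other. The two statements are proved
  together: each step of the iteration needs the formula on a neighbourhood of \<open>x\<close>.
\<close>

lemma iter_partial_hol_ext:
  fixes a :: "'d::finite \<Rightarrow> nat \<Rightarrow> complex"
  assumes F: "F holomorphic_on D" "open D"
    and u: "\<And>x. xi a x 0 \<in> D \<Longrightarrow> u x = hol_ext \<Upsilon> F (xi a x) k"
  defines "V \<equiv> \<lambda>js x. foldr (\<lambda>j. seq_mult \<Upsilon> (a j)) js (hol_ext \<Upsilon> ((deriv ^^ length js) F) (xi a x)) k"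
  shows "xi a x 0 \<in> D \<Longrightarrow> iter_partial js u x = V js x"
    and "xi a x 0 \<in> D \<Longrightarrow>
      ((\<lambda>h. iter_partial js u (x + h *\<^sub>R axis j 1)) has_vector_derivative V (j # js) x) (at 0)"
proof -
  have step: "((\<lambda>h. iter_partial js u (x + h *\<^sub>R axis j 1)) has_vector_derivative V (j # js) x) (at 0)"
    if eq: "\<And>x. xi a x 0 \<in> D \<Longrightarrow> iter_partial js u x = V js x" and x: "xi a x 0 \<in> D" for js j x
  proof -
    let ?G = "(deriv ^^ length js) F" and ?x = "\<lambda>h. x + h *\<^sub>R axis j 1"
    have G: "?G holomorphic_on D" using F by (rule holomorphic_higher_deriv)
    have move: "foldr (\<lambda>j. seq_mult \<Upsilon> (a j)) js (seq_mult \<Upsilon> (a j) v) =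
        seq_mult \<Upsilon> (a j) (foldr (\<lambda>j. seq_mult \<Upsilon> (a j)) js v)" for v
      by (induction js) (simp_all add: seq_mult_left_commute[of _ "a j"])
    have "((\<lambda>h. xi a (?x h) i) has_vector_derivative a j i) (at 0)" for i
      unfolding xi_axis by (auto intro!: derivative_eq_intros)
    then have "((\<lambda>h. hol_ext \<Upsilon> ?G (xi a (?x h)) i) has_vector_derivative
        seq_mult \<Upsilon> (a j) (hol_ext \<Upsilon> (deriv ?G) (xi a x)) i) (at 0)" for i
      using has_vector_derivative_hol_ext[OF G F(2), of "\<lambda>h. xi a (?x h)" 0] x by simp
    from has_vector_derivative_foldr_seq_mult[where v = "\<lambda>h. hol_ext \<Upsilon> ?G (xi a (?x h))", OF this,
        of \<Upsilon> a js k]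
    have deriv: "((\<lambda>h. V js (?x h)) has_vector_derivative V (j # js) x) (at 0)"
      unfolding V_def move by simp
    show ?thesis
    proof (rule has_vector_derivative_transform_within_open[OF deriv])
      have "continuous_on UNIV (\<lambda>h. xi a (?x h) 0)"
        unfolding xi_axis by (intro continuous_intros)
      then show "open ((\<lambda>h. xi a (?x h) 0) -` D)"
        using F(2) by (simp add: continuous_on_open_vimage)
    qed (use x eq in auto)
  qed
  have eq: "iter_partial js u x = V js x" if "xi a x 0 \<in> D" for x js
    using that
  proof (induction js arbitrary: x)
    case Nil
    then show ?case using u by (simp add: iter_partial_def V_def)
  next
    case (Cons j js)
    have "iter_partial (j # js) u x = vector_derivative (\<lambda>h. iter_partial js u (x + h *\<^sub>R axis j 1)) (at 0)"
      by (simp add: iter_partial_def partial_deriv_def)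
    also have "\<dots> = V (j # js) x"
      by (rule vector_derivative_at[OF step[OF Cons.IH Cons.prems]])
    finally show ?case .
  qed
  then show "xi a x 0 \<in> D \<Longrightarrow> iter_partial js u x = V js x" .
  show "((\<lambda>h. iter_partial js u (x + h *\<^sub>R axis j 1)) has_vector_derivative V (j # js) x) (at 0)"
    if "xi a x 0 \<in> D" by (rule step[OF eq that])
qed

lemma classical_solution_hol_ext:
  fixes a :: "'d::{finite,linorder} \<Rightarrow> nat \<Rightarrow> complex"
  assumes F: "F holomorphic_on D" "open D"
    and char: "characteristic_equation p C E I a"
    and u: "\<And>x. xi a x 0 \<in> D \<Longrightarrow> u x = hol_ext \<Upsilon> F (xi a x) k"
  shows "classical_solution_on p C u {x. xi a x 0 \<in> D}"
proof -
  let ?S = "{x. xi a x 0 \<in> D}"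
  note iter = iter_partial_hol_ext[OF F u]
  have "continuous_on ?S (\<lambda>x. hol_ext \<Upsilon> ((deriv ^^ n) F) (xi a x) i)" for n i
  proof -
    have "continuous_on D ((deriv ^^ m) ((deriv ^^ n) F))" for m
      using F by (intro holomorphic_on_imp_continuous_on holomorphic_higher_deriv)
    then have "continuous_on ?S (\<lambda>x. (deriv ^^ m) ((deriv ^^ n) F) (xi a x 0))" for m
      by (rule continuous_on_compose2[OF _ continuous_on_xi]) auto
    moreover have "continuous_on ?S (\<lambda>x. nil_part (xi a x) i)" for i
      by (cases "i = 0") (auto simp: nil_part_def continuous_on_xi)
    ultimately show ?thesis
      unfolding hol_ext_def by (intro continuous_intros continuous_on_seq_pow) auto
  qed
  then have "continuous_on ?S (\<lambda>x. foldr (\<lambda>j. seq_mult \<Upsilon> (a j)) js (hol_ext \<Upsilon> ((deriv ^^ n) F) (xi a x)) i)"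
    for js n i
    by (induction js arbitrary: i) (auto intro!: continuous_on_seq_mult)
  then have "continuous_on ?S (iter_partial js u)" for js
    by (subst continuous_on_cong[OF refl iter(1)]) auto
  moreover have "(\<lambda>h. iter_partial js u (x + h *\<^sub>R axis j 1)) differentiable (at 0)" if "x \<in> ?S" for x js j
    using iter(2)[of x js j] that by (auto simp: has_vector_derivative_def differentiable_def)
  moreover have "pde_operator p C u x = 0" if x: "x \<in> ?S" for x
  proof -
    let ?l = "\<lambda>\<alpha>. concat (map (\<lambda>j. replicate (\<alpha> j) j) (sorted_list_of_set (UNIV :: 'd set)))"
    have "length (?l \<alpha>) = p" if "\<alpha> \<in> multi_indices p" for \<alpha>
    proof -
      have "length (?l \<alpha>) = (\<Sum>j\<in>UNIV. \<alpha> j)"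
        by (simp add: length_concat o_def sum_list_distinct_conv_sum_set)
      then show ?thesis using that by (simp add: multi_indices_def)
    qed
    then have "pde_operator p C u x = (\<Sum>\<alpha>\<in>multi_indices p. of_real (C \<alpha>) *
        foldr (\<lambda>j. seq_mult \<Upsilon> (a j)) (?l \<alpha>) (hol_ext \<Upsilon> ((deriv ^^ p) F) (xi a x)) k)"
      unfolding pde_operator_def mixed_partial_def using iter(1) x by (intro sum.cong) auto
    also have "\<dots> = 0" by (rule characteristic_equation_seq[OF char])
    finally show ?thesis .
  qed
  ultimately show ?thesis
    by (auto simp: classical_solution_on_def C_k_on_def)
qed

end

theorem mainTheorem3:
  fixes p :: nat
    and C :: "('d::{finite,linorder} \<Rightarrow> nat) \<Rightarrow> real"
    and E :: "nat \<Rightarrow> (complex, 'e) module"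
    and I :: "nat \<Rightarrow> nat \<Rightarrow> 'e"
    and \<Upsilon> :: "nat \<Rightarrow> nat \<Rightarrow> nat \<Rightarrow> complex"
    and a :: "'d::{finite,linorder} \<Rightarrow> nat \<Rightarrow> complex"
    and D :: "complex set"
    and F :: "nat \<Rightarrow> complex \<Rightarrow> complex"
    and \<Gamma> :: "nat \<Rightarrow> real^('d::{finite,linorder}) \<Rightarrow> real \<Rightarrow> complex"
    and U :: "nat \<Rightarrow> real^('d::{finite,linorder}) \<Rightarrow> complex"
  assumes "CARD('d) \<ge> 2" and "p \<ge> 1"
    and "extension_sequence E I \<Upsilon>"
    and "characteristic_equation p C E I a"
    and "\<exists>j. a j 0 \<notin> \<real>"
    and "open D" and "connected D" and "D \<noteq> {}"
    and "\<And>k. F k holomorphic_on D"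
    and "\<And>k x. xi a x 0 \<in> D \<Longrightarrow> jordan_contour D (xi a x 0) (\<Gamma> k x)"
    and "\<And>k x. xi a x 0 \<in> D \<Longrightarrow>
           U k x = 1 / (2 * of_real pi * \<i>) *
             line_integral (\<Gamma> k x) (\<lambda>t. F k t * A_coeff \<Upsilon> (xi a x) t k)"
  shows "\<forall>k. classical_solution_on p C (U k) {x. xi a x 0 \<in> D}"
proof
  fix k
  interpret extension_seq E I \<Upsilon> using assms(3) by unfold_locales
  show "classical_solution_on p C (U k) {x. xi a x 0 \<in> D}"
  proof (rule classical_solution_hol_ext[OF assms(9)[of k] assms(6) assms(4)])
    fix x assume x: "xi a x 0 \<in> D"
    let ?z = "xi a x"
    have "line_integral (\<Gamma> k x) (\<lambda>t. F k t * A_coeff \<Upsilon> ?z t k) =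
        2 * of_real pi * \<i> * (\<Sum>m\<le>k. seq_pow \<Upsilon> (nil_part ?z) m k * (deriv ^^ m) (F k) (?z 0) / fact m)"
      unfolding A_coeff_eq_sum_seq_pow
      by (rule line_integral_jordan_contour[OF assms(6,7) assms(10)[OF x] assms(9)])
    also have "\<dots> = 2 * of_real pi * \<i> * hol_ext \<Upsilon> (F k) ?z k"
      by (simp add: hol_ext_def mult.commute)
    finally show "U k x = hol_ext \<Upsilon> (F k) ?z k"
      using assms(11)[OF x, of k] by simp
  qed
qed

end
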